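(* Let $\mathcal{A}$ be an infinite set. Then the topological space $\Sigma_{\mathcal{A}}$ (the set of all finite and infinite sequences of elements of $\mathcal{A}$, with the quotient topology described in the context) is a compact Hausdorff space.
   Context: Let $\mathcal{A}$ be an infinite set (the alphabet) and $\mathbb{N}=\{1,2,3,\ldots\}$. Put $\mathcal{A}^0=\{\vec{0}\}$ where $\vec{0}$ is the empty sequence, let $\mathcal{A}^k$ be the $k$-fold product for $k\in\mathbb{N}$, let $\mathcal{A}^{\mathbb{N}}=\mathcal{A}\times\mathcal{A}\times\cdots$, and let $\Sigma_{\mathcal{A}}:=\mathcal{A}^{\mathbb{N}}\sqcup\bigcup_{k=0}^\infty\mathcal{A}^k$. Topology: give $\mathcal{A}$ the discrete topology and let $\mathcal{A}_\infty=\mathcal{A}\cup\{\infty\}$ be its one-point compactification (open sets: all subsets of $\mathcal{A}$ and all complements $\mathcal{A}_\infty\setminus F$ of finite sets $F\subseteq\mathcal{A}$). Let $X_{\mathcal{A}}=\mathcal{A}_\infty\times\mathcal{A}_\infty\times\cdots$ (countably many factors) with the product topology. Define the surjection $Q:X_{\mathcal{A}}\to\Sigma_{\mathcal{A}}$ by $Q(x_1x_2\ldots)=\vec{0}$ if $x_1=\infty$; $Q(x_1x_2\ldots)=x_1\ldots x_n$ if $x_{n+1}=\infty$ and $x_i\neq\infty$ for $1\le i\le n$; and $Q(x_1x_2\ldots)=x_1x_2x_3\ldots$ if $x_i\ne\infty$ for all $i$. The space $\Sigma_{\mathcal{A}}$ has the quotient topology induced by $Q$: $U\subseteq\Sigma_{\mathcal{A}}$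 is open if and only if $Q^{-1}(U)$ is open in $X_{\mathcal{A}}$. *)

theory Defs
  imports "HOL-Analysis.Analysis"
begin

text \<open>
  Finite sequences over \<open>A\<close> are lists (\<open>Inl []\<close> is the empty sequence) and infinite sequences
  are functions on \<open>nat\<close>, the two kinds being kept apart by the sum type.
  Coordinates are numbered from 0, so \<open>x i\<close> is the entry usually written \<open>x\<^sub>i\<^sub>+\<^sub>1\<close>.
\<close>

definition seq_space :: "'a set \<Rightarrow> ('a list + (nat \<Rightarrow> 'a)) set" where
  "seq_space A = Inl ` {w. set w \<subseteq> A} \<union> Inr ` {f. range f \<subseteq> A}"

text \<open>In the one-point compactification, \<open>None\<close> is the point at infinity and \<open>Some a\<close> the letter \<open>a\<close>.\<close>

definition alphabet_compactification :: "'a set \<Rightarrow> 'a option topology" where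
  "alphabet_compactification A = Alexandroff_compactification (discrete_topology A)"

lemma topspace_alphabet_compactification [simp]:
  "topspace (alphabet_compactification A) = insert None (Some ` A)"
  by (simp add: alphabet_compactification_def)

lemma openin_alphabet_compactification:
  "openin (alphabet_compactification A) U \<longleftrightarrow>
     (\<exists>V. V \<subseteq> A \<and> U = Some ` V) \<or>
     (\<exists>F. F \<subseteq> A \<and> finite F \<and> U = insert None (Some ` A) - Some ` F)"
proof -
  have "insert None (Some ` (A - F)) = insert None (Some ` A) - Some ` F" for F
    by auto
  then show ?thesis
    by (auto simp: alphabet_compactification_def openin_Alexandroff_compactification
        compactin_discrete_topology)
qed

definition product_space :: "'a set \<Rightarrow> (nat \<Rightarrow> 'a option) topology" where
  "product_space A = product_topology (\<lambda>_. alphabet_compactification A) UNIV"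

lemma topspace_product_space:
  "topspace (product_space A) = {x. range x \<subseteq> insert None (Some ` A)}"
  by (auto simp: product_space_def PiE_def Pi_def)

definition seq_quotient :: "(nat \<Rightarrow> 'a option) \<Rightarrow> 'a list + (nat \<Rightarrow> 'a)" where
  "seq_quotient x = (if \<exists>n. x n = None
          then Inl (map (\<lambda>i. the (x i)) [0..<(LEAST n. x n = None)])
          else Inr (\<lambda>i. the (x i)))"

lemma seq_quotient_finite:
  assumes "x n = None" and "\<And>i. i < n \<Longrightarrow> x i = Some (y i)"
  shows "seq_quotient x = Inl (map y [0..<n])"
proof -
  have "(LEAST n. x n = None) = n"
    using assms by (metis (mono_tags, lifting) Least_equality not_le option.distinct(1))
  then show ?thesis
    using assms by (auto simp: seq_quotient_def)
qed

lemma seq_quotient_infinite: "(\<And>i. x i = Some (y i)) \<Longrightarrow> seq_quotient x = Inr y"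
  by (simp add: seq_quotient_def)

lemma seq_quotient_image: "seq_quotient ` topspace (product_space A) = seq_space A"
proof (intro equalityI subsetI)
  fix s assume "s \<in> seq_quotient ` topspace (product_space A)"
  then obtain x where s: "s = seq_quotient x" and x: "range x \<subseteq> insert None (Some ` A)"
    unfolding topspace_product_space by blast
  have *: "the (x i) \<in> A" if "x i \<noteq> None" for i
    using subsetD[OF x rangeI[of x i]] that by auto
  show "s \<in> seq_space A"
  proof (cases "\<exists>n. x n = None")
    case True
    have "the (x i) \<in> A" if "i < (LEAST n. x n = None)" for i
      using * not_less_Least[OF that] by blast
    then have "set (map (\<lambda>i. the (x i)) [0..<(LEAST n. x n = None)]) \<subseteq> A"
      by auto
    with True show ?thesis unfolding s seq_quotient_def seq_space_def by simp
  next
    case False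
    then have "range (\<lambda>i. the (x i)) \<subseteq> A"
      using * by auto
    with False show ?thesis unfolding s seq_quotient_def seq_space_def by simp
  qed
next
  fix s assume "s \<in> seq_space A"
  then consider w where "s = Inl w" "set w \<subseteq> A" | f where "s = Inr f" "range f \<subseteq> A"
    by (auto simp: seq_space_def)
  then show "s \<in> seq_quotient ` topspace (product_space A)"
  proof cases
    case 1
    define x where "x i = (if i < length w then Some (w ! i) else None)" for i
    have "seq_quotient x = Inl (map ((!) w) [0..<length w])"
      by (rule seq_quotient_finite) (auto simp: x_def)
    then have "s = seq_quotient x"
      by (simp add: 1 map_nth)
    moreover have "w ! i \<in> A" if "i < length w" for i
      using 1 that nth_mem by blast
    then have "x \<in> topspace (product_space A)"
      by (auto simp: topspace_product_space x_def)
    ultimately show ?thesis by blast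
  next
    case 2
    have "s = seq_quotient (\<lambda>i. Some (f i))"
      using 2 by (simp add: seq_quotient_infinite)
    moreover have "(\<lambda>i. Some (f i)) \<in> topspace (product_space A)"
      using 2 by (auto simp: topspace_product_space)
    ultimately show ?thesis by blast
  qed
qed

definition seq_topology :: "'a set \<Rightarrow> ('a list + (nat \<Rightarrow> 'a)) topology" where
  "seq_topology A = topology (\<lambda>U. U \<subseteq> seq_space A \<and>
     openin (product_space A) {x \<in> topspace (product_space A). seq_quotient x \<in> U})"

lemma openin_seq_topology:
  "openin (seq_topology A) U \<longleftrightarrow> U \<subseteq> seq_space A \<and>
     openin (product_space A) {x \<in> topspace (product_space A). seq_quotient x \<in> U}"
proof -
  let ?P = "\<lambda>U. {x \<in> topspace (product_space A). seq_quotient x \<in> U}"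
  have "?P (S \<inter> T) = ?P S \<inter> ?P T" for S T
    by auto
  moreover have "?P (\<Union>K) = \<Union>(?P ` K)" for K
    by auto
  ultimately have "istopology (\<lambda>U. U \<subseteq> seq_space A \<and> openin (product_space A) (?P U))"
    unfolding istopology_def by (auto simp del: Collect_conj_eq)
  then show ?thesis
    by (simp add: seq_topology_def topology_inverse')
qed

lemma topspace_seq_topology [simp]: "topspace (seq_topology A) = seq_space A"
proof
  show "topspace (seq_topology A) \<subseteq> seq_space A"
    using openin_seq_topology[of A "topspace (seq_topology A)"] by simp
  have "{x \<in> topspace (product_space A). seq_quotient x \<in> seq_space A} = topspace (product_space A)"
    using seq_quotient_image by blast
  then have "openin (seq_topology A) (seq_space A)"
    by (simp add: openin_seq_topology)
  then show "seq_space A \<subseteq> topspace (seq_topology A)"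
    by (rule openin_subset)
qed

lemma quotient_map_seq_quotient: "quotient_map (product_space A) (seq_topology A) seq_quotient"
  by (auto simp: quotient_map_def seq_quotient_image openin_seq_topology)

end

theory Submission
  imports Defs
begin

text \<open>
  Compactness is Tychonoff's theorem for the product space, carried over by the quotient map.
  For the Hausdorff property, the cylinder of all sequences that begin with a given word is
  clopen, because every letter is isolated in the one-point compactification and its singleton
  is closed there. Distinct sequences have different sets of initial words, so some cylinder
  contains exactly one of them.
\<close>

text \<open>Phrased on the product space, where it constrains finitely many coordinates. It asks for
  letters only, so it can hold only if \<open>w\<close> ends before the first \<open>None\<close>;
  entries after that \<open>None\<close> have no influence.\<close>

definition starts_with :: "'a list \<Rightarrow> (nat \<Rightarrow> 'a option) \<Rightarrow> bool" where
  "starts_with w x \<longleftrightarrow> (\<forall>i<length w. x i = Some (w ! i))"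

text \<open>Points with the same image have their first \<open>None\<close> at the same place, if at
  all, and carry the same letters before it. This makes the set of points starting with
  \<open>w\<close> saturated for \<open>seq_quotient\<close>.\<close>

lemma starts_with_seq_quotient_mono:
  assumes eq: "seq_quotient x = seq_quotient y" and w: "starts_with w x"
  shows "starts_with w y"
proof (cases "\<exists>n. x n = None")
  case True
  let ?m = "LEAST n. x n = None" and ?k = "LEAST n. y n = None"
  have maps: "map (\<lambda>i. the (x i)) [0..<?m] = map (\<lambda>i. the (y i)) [0..<?k]"
    using eq True by (auto simp: seq_quotient_def split: if_splits)
  then have mk: "?m = ?k"
    using map_eq_imp_length_eq[OF maps] by simp
  have xm: "x ?m = None"
    using True by (rule LeastI_ex)
  show ?thesis
    unfolding starts_with_def
  proof (intro allI impI)
    fix i assume i: "i < length w"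
    \<comment> \<open>\<open>w\<close> puts a letter at each position below its length, so the first
      \<open>None\<close> of \<open>x\<close> cannot occur there.\<close>
    have "\<not> ?m < length w"
      using w xm by (auto simp: starts_with_def)
    then have im: "i < ?m"
      using i by linarith
    then have "y i \<noteq> None"
      unfolding mk by (rule not_less_Least)
    moreover have "the (x i) = the (y i)"
      using maps im unfolding mk by simp
    moreover have "x i = Some (w ! i)"
      using w i unfolding starts_with_def by blast
    ultimately show "y i = Some (w ! i)"
      by auto
  qed
next
  case False
  then have "seq_quotient x = Inr (\<lambda>i. the (x i))"
    unfolding seq_quotient_def by (rule if_not_P)
  \<comment> \<open>A \<open>None\<close> in \<open>y\<close> would make its image an
    \<open>Inl\<close>, while the image of \<open>x\<close> is an \<open>Inr\<close>.\<close>
  then have "(\<lambda>i. the (x i)) = (\<lambda>i. the (y i))" "\<forall>n. y n \<noteq> None"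
    using eq unfolding seq_quotient_def[of y] by (auto split: if_split_asm)
  then have "y i = Some (the (x i))" for i
    by (simp add: fun_eq_iff)
  then show ?thesis
    using w by (simp add: starts_with_def)
qed

lemma starts_with_prefix:
  assumes "\<And>i. i < n \<Longrightarrow> x i \<noteq> None"
  shows "starts_with (map (\<lambda>i. the (x i)) [0..<n]) x"
  using assms by (auto simp: starts_with_def)

text \<open>The initial words fix the letters up to the first \<open>None\<close> and the position
  of that \<open>None\<close>. Nothing is determined beyond it, so only the images agree, not the
  points themselves.\<close>

lemma seq_quotient_eqI:
  assumes same: "\<And>w. starts_with w x \<longleftrightarrow> starts_with w y"
  shows "seq_quotient x = seq_quotient y"
proof -
  \<comment> \<open>Kept one-sided, with letters required of \<open>u\<close> alone, so that it can
    be applied with \<open>x\<close> and \<open>y\<close> in either role.\<close>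
  have agree: "u i = v i"
    if "\<And>w. starts_with w u \<Longrightarrow> starts_with w v" "\<And>j. j \<le> i \<Longrightarrow> u j \<noteq> None"
    for u v :: "nat \<Rightarrow> 'a option" and i
  proof -
    \<comment> \<open>Length \<open>Suc i\<close> makes the word include position \<open>i\<close>
      itself.\<close>
    have "starts_with (map (\<lambda>i. the (u i)) [0..<Suc i]) v"
      using that starts_with_prefix[of "Suc i" u] by simp
    then have "v i = Some (the (u i))"
      by (auto simp: starts_with_def simp del: upt_Suc)
    then show ?thesis
      using that by simp
  qed
  show ?thesis
  proof (cases "\<exists>n. x n = None")
    case True
    define n where "n = (LEAST n. x n = None)"
    have xn: "x n = None"
      unfolding n_def using True by (rule LeastI_ex)
    have x: "x i \<noteq> None" if "i < n" for i
      using that not_less_Least unfolding n_def by blast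
    have y: "x i = y i" if "i < n" for i
      using agree[of x y i] same x that by simp
    have yn: "y n = None"
    proof (rule ccontr)
      assume "y n \<noteq> None"
      then have "y j \<noteq> None" if "j \<le> n" for j
        using that x y by (metis le_neq_implies_less)
      \<comment> \<open>Here \<open>y\<close> plays the role of \<open>u\<close>: a letter of
        \<open>y\<close> at position \<open>n\<close> would force the same letter in
        \<open>x\<close>.\<close>
      then have "y n = x n"
        using agree[of y x n] same by simp
      with xn \<open>y n \<noteq> None\<close> show False by simp
    qed
    have "seq_quotient x = Inl (map (\<lambda>i. the (x i)) [0..<n])"
      using x xn by (intro seq_quotient_finite) auto
    moreover have "y i = Some (the (x i))" if "i < n" for i
      using x[OF that] y[OF that] by simp
    with yn have "seq_quotient y = Inl (map (\<lambda>i. the (x i)) [0..<n])"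
      by (rule seq_quotient_finite)
    ultimately show ?thesis by simp
  next
    case False
    then have "x = y"
      using agree[of x y] same by auto
    then show ?thesis by simp
  qed
qed

lemma clopen_letter:
  assumes "a \<in> A"
  shows "openin (alphabet_compactification A) {Some a}"
    and "closedin (alphabet_compactification A) {Some a}"
proof -
  have "{a} \<subseteq> A \<and> {Some a} = Some ` {a}"
    using assms by simp
  then show "openin (alphabet_compactification A) {Some a}"
    unfolding openin_alphabet_compactification by blast
  have "{a} \<subseteq> A \<and> finite {a} \<and>
      insert None (Some ` A) - {Some a} = insert None (Some ` A) - Some ` {a}"
    using assms by simp
  then have "openin (alphabet_compactification A) (insert None (Some ` A) - {Some a})"
    unfolding openin_alphabet_compactification by blast
  then show "closedin (alphabet_compactification A) {Some a}"
    using assms by (simp add: closedin_def)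
qed

lemma clopen_starts_with:
  shows "openin (product_space A) {x \<in> topspace (product_space A). starts_with w x}"
    and "closedin (product_space A) {x \<in> topspace (product_space A). starts_with w x}"
proof -
  let ?X = "product_space A"
  let ?C = "\<lambda>i. {x \<in> topspace ?X. x i = Some (w ! i)}"
  have "openin ?X (?C i) \<and> closedin ?X (?C i)" for i
  proof (cases "w ! i \<in> A")
    case True
    have "continuous_map ?X (alphabet_compactification A) (\<lambda>x. x i)"
      unfolding product_space_def by (rule continuous_map_product_projection) simp
    from openin_continuous_map_preimage[OF this clopen_letter(1)[OF True]]
      closedin_continuous_map_preimage[OF this clopen_letter(2)[OF True]]
    show ?thesis by simp
  next
    case False
    \<comment> \<open>A letter outside \<open>A\<close> occurs in no point of the space, so its
      coordinate condition defines the empty set, which is clopen.\<close>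
    have "x i \<noteq> Some (w ! i)" if "x \<in> topspace ?X" for x
    proof -
      have "x i \<in> insert None (Some ` A)"
        using that unfolding topspace_product_space by blast
      then show ?thesis using False by auto
    qed
    then have "?C i = {}" by blast
    then show ?thesis by (simp only: openin_empty closedin_empty simp_thms)
  qed
  then have clopen: "openin ?X U \<and> closedin ?X U"
    if "U \<in> insert (topspace ?X) (?C ` {..<length w})" for U
    using that by (elim insertE imageE) (simp_all only: openin_topspace closedin_topspace simp_thms)
  \<comment> \<open>Inserting the whole space covers the empty word, where the intersection over no
    coordinates would be \<open>UNIV\<close>.\<close>
  have eq: "{x \<in> topspace ?X. starts_with w x} =
      \<Inter>(insert (topspace ?X) (?C ` {..<length w}))"
    by (auto simp: starts_with_def)
  show "openin ?X {x \<in> topspace ?X. starts_with w x}"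
    unfolding eq
  proof (rule openin_Inter)
    show "finite (insert (topspace ?X) (?C ` {..<length w}))"
      by simp
  qed (use clopen in blast)+
  show "closedin ?X {x \<in> topspace ?X. starts_with w x}"
    unfolding eq by (rule closedin_Inter) (use clopen in blast)+
qed

definition cylinder :: "'a set \<Rightarrow> 'a list \<Rightarrow> ('a list + (nat \<Rightarrow> 'a)) set" where
  "cylinder A w = seq_quotient ` {x \<in> topspace (product_space A). starts_with w x}"

text \<open>By saturation, the preimage of the cylinder is no larger than the set whose image it
  is.\<close>

lemma seq_quotient_in_cylinder:
  assumes "x \<in> topspace (product_space A)"
  shows "seq_quotient x \<in> cylinder A w \<longleftrightarrow> starts_with w x"
proof
  assume "seq_quotient x \<in> cylinder A w"
  then obtain y where "seq_quotient y = seq_quotient x" "starts_with w y"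
    by (auto simp: cylinder_def)
  then show "starts_with w x"
    by (rule starts_with_seq_quotient_mono)
qed (use assms in \<open>auto simp: cylinder_def\<close>)

text \<open>A quotient map reflects openness and closedness from preimages, and the preimage of the
  cylinder is the clopen set of points starting with \<open>w\<close>.\<close>

lemma clopen_cylinder:
  shows "openin (seq_topology A) (cylinder A w)" and "closedin (seq_topology A) (cylinder A w)"
proof -
  have sub: "cylinder A w \<subseteq> topspace (seq_topology A)"
    unfolding cylinder_def topspace_seq_topology seq_quotient_image[symmetric] by blast
  have pre: "{x \<in> topspace (product_space A). seq_quotient x \<in> cylinder A w}
      = {x \<in> topspace (product_space A). starts_with w x}"
    using seq_quotient_in_cylinder by blast
  note quot = quotient_map_seq_quotient[of A]
  show "openin (seq_topology A) (cylinder A w)"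
    using quot[unfolded quotient_map_def, THEN conjunct2, rule_format, OF sub]
    unfolding pre by (simp only: clopen_starts_with)
  show "closedin (seq_topology A) (cylinder A w)"
    using quot[unfolded quotient_map_closedin, THEN conjunct2, rule_format, OF sub]
    unfolding pre by (simp only: clopen_starts_with)
qed

lemma compact_space_seq_topology: "compact_space (seq_topology A)"
proof -
  have "compact_space (product_space A)"
    by (simp add: product_space_def compact_space_product_topology alphabet_compactification_def
        compact_space_Alexandroff_compactification)
  then have "compactin (seq_topology A) (seq_quotient ` topspace (product_space A))"
    unfolding compact_space_def
    by (rule image_compactin[OF _ quotient_imp_continuous_map[OF quotient_map_seq_quotient]])
  then show ?thesis
    by (simp add: compact_space_def seq_quotient_image)
qed

lemma Hausdorff_space_seq_topology: "Hausdorff_space (seq_topology A)"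
  unfolding Hausdorff_space_def
proof (intro allI impI, elim conjE)
  fix s t assume s: "s \<in> topspace (seq_topology A)" and t: "t \<in> topspace (seq_topology A)"
    and "s \<noteq> t"
  from s t obtain x y where x: "x \<in> topspace (product_space A)" "s = seq_quotient x"
    and y: "y \<in> topspace (product_space A)" "t = seq_quotient y"
    unfolding topspace_seq_topology seq_quotient_image[symmetric] by blast
  obtain w where "starts_with w x \<noteq> starts_with w y"
    using seq_quotient_eqI \<open>s \<noteq> t\<close> x y by blast
  then have w: "s \<in> cylinder A w \<longleftrightarrow> t \<notin> cylinder A w"
    unfolding x(2) y(2) seq_quotient_in_cylinder[OF x(1)] seq_quotient_in_cylinder[OF y(1)] by blast
  \<comment> \<open>The cylinder and its complement are the separating open sets; the case split
    decides which one contains \<open>s\<close>.\<close>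
  let ?V = "topspace (seq_topology A) - cylinder A w"
  have U: "openin (seq_topology A) (cylinder A w)"
    by (rule clopen_cylinder)
  have V: "openin (seq_topology A) ?V"
    using clopen_cylinder(2)[of A w] by (simp add: closedin_def)
  show "\<exists>U V. openin (seq_topology A) U \<and> openin (seq_topology A) V \<and> s \<in> U \<and> t \<in> V \<and> disjnt U V"
  proof (cases "s \<in> cylinder A w")
    case True
    then have "t \<in> ?V" "disjnt (cylinder A w) ?V"
      using w t by (auto simp: disjnt_def)
    then show ?thesis using U V True by blast
  next
    case False
    then have "s \<in> ?V" "t \<in> cylinder A w" "disjnt ?V (cylinder A w)"
      using w s by (auto simp: disjnt_def)
    then show ?thesis using U V by blast
  qed
qed

theorem proposition2p5:
  fixes A :: "'a set"
  assumes "infinite A"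
  shows "compact_space (seq_topology A) \<and> Hausdorff_space (seq_topology A)"
  by (simp add: compact_space_seq_topology Hausdorff_space_seq_topology)

end
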